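(* Let $\nu>-1$. Then for every integer $n\ge1$, $$\sum_{k \ge 1} \frac{1}{\Big[\big[(j_n^{\nu+1})' \big]^2 - \big(j_k^{\nu}\big)^2 \Big]^2} = \frac{1}{4(\nu+1)^2} - \frac{1}{4 \big[(j_n^{\nu+1})'\big]^2}.$$
   Context: For $\mu>-1$, $\{j_n^{\mu}: n\ge1\}$ denotes the sequence of strictly positive zeros, in ascending order, of the Bessel function of the first kind $J_\mu$, and $\{(j_n^{\mu})': n\ge1\}$ denotes the sequence of strictly positive zeros, in ascending order, of the derivative $J_\mu'$; the prime in $(j_n^\mu)'$ is only notation. *)

theory Defs
  imports "HOL-Analysis.Analysis"
begin

(* The power series of J_mu; powr makes this the principal real branch, so it is
   meaningful for x > 0 only, which is all that is used. *)
definition bessel_J :: "real \<Rightarrow> real \<Rightarrow> real" where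
  "bessel_J \<mu> x =
     (\<Sum>m. (-1) ^ m / (fact m * Gamma (real m + \<mu> + 1)) * (x / 2) powr (2 * real m + \<mu>))"

(* The sequence is indexed from 1; the value at 0 is fixed only so that the
   description determines the whole function (lemma pos_zeros_eqI). *)
definition pos_zeros :: "(real \<Rightarrow> real) \<Rightarrow> nat \<Rightarrow> real" where
  "pos_zeros f =
     (THE j. strict_mono_on {1..} j \<and> j ` {1..} = {x. 0 < x \<and> f x = 0} \<and> j 0 = 0)"

definition bessel_zero :: "real \<Rightarrow> nat \<Rightarrow> real" where
  "bessel_zero \<mu> = pos_zeros (bessel_J \<mu>)"

definition bessel_deriv_zero :: "real \<Rightarrow> nat \<Rightarrow> real" where
  "bessel_deriv_zero \<mu> = pos_zeros (deriv (bessel_J \<mu>))"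

lemma strict_mono_on_image_unique:
  fixes i j :: "nat \<Rightarrow> real"
  assumes i: "strict_mono_on {1..} i" and j: "strict_mono_on {1..} j"
    and eq: "i ` {1..} = j ` {1..}" and "n \<ge> 1"
  shows "i n = j n"
  using \<open>n \<ge> 1\<close>
proof (induction n rule: less_induct)
  case (less n)
  have le: "b n \<le> a n"
    if a: "strict_mono_on {1..} a" and b: "strict_mono_on {1..} b"
      and ab: "a ` {1..} = b ` {1..}" and IH: "\<And>m. m < n \<Longrightarrow> 1 \<le> m \<Longrightarrow> a m = b m"
    for a b :: "nat \<Rightarrow> real"
  proof -
    have "a n \<in> b ` {1..}"
      using less.prems unfolding ab[symmetric] by simp
    then obtain m where m: "m \<ge> 1" "a n = b m"
      by auto
    have "\<not> m < n"
    proof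
      assume "m < n"
      with IH m have "a n = a m" by simp
      moreover have "a m < a n"
        using strict_mono_onD[OF a, of m n] m(1) less.prems \<open>m < n\<close> by simp
      ultimately show False by simp
    qed
    then show ?thesis
      using strict_mono_onD[OF b, of n m] m less.prems by (cases "m = n") auto
  qed
  show ?case
  proof (rule order_antisym)
    show "i n \<le> j n" using le[OF j i eq[symmetric]] less.IH by simp
    show "j n \<le> i n" using le[OF i j eq] less.IH by simp
  qed
qed

lemma pos_zeros_eqI:
  assumes "strict_mono_on {1..} j" and "j ` {1..} = {x. 0 < x \<and> f x = 0}" and "j 0 = 0"
  shows "pos_zeros f = j"
  unfolding pos_zeros_def
proof (rule the_equality)
  show "strict_mono_on {1..} j \<and> j ` {1..} = {x. 0 < x \<and> f x = 0} \<and> j 0 = 0"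
    using assms by blast
next
  fix i :: "nat \<Rightarrow> real"
  assume "strict_mono_on {1..} i \<and> i ` {1..} = {x. 0 < x \<and> f x = 0} \<and> i 0 = 0"
  with assms have "i n = j n" for n
    using strict_mono_on_image_unique[of i j n] by (cases n) auto
  then show "i = j" by blast
qed

end

theory Submission imports Defs "HOL-Complex_Analysis.Complex_Analysis" begin

text \<open>
  Let \<open>C\<^sub>\<nu>(z) = \<Sum>\<^sub>m z\<^sup>m / (m! \<Gamma>(m + \<nu> + 1))\<close> be the Bessel--Clifford function. It is entire,
  \<open>J\<^sub>\<nu>(x) = (x/2)\<^sup>\<nu> C\<^sub>\<nu>(-x\<^sup>2/4)\<close> for \<open>x > 0\<close>, its derivative is \<open>C\<^sub>\<nu>\<^sub>+\<^sub>1\<close>, and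
  \<open>C\<^sub>\<nu> = (\<nu> + 1) C\<^sub>\<nu>\<^sub>+\<^sub>1 + z C\<^sub>\<nu>\<^sub>+\<^sub>2\<close>. Under \<open>a = -x\<^sup>2/4\<close> the positive zeros of \<open>J\<^sub>\<nu>\<close> correspond to
  all the complex zeros of \<open>C\<^sub>\<nu>\<close>: these are real (an energy argument for the differential equation
  along the segment from 0 to a zero, \<open>bessel_clifford_zero_real\<close>), negative (the coefficients are
  positive) and simple (\<open>bessel_clifford_simple_zero\<close>).

  Since \<open>C\<^sub>\<nu>\<close> grows more slowly than every \<open>exp (e |z|)\<close> with \<open>e > 0\<close>, its logarithmic derivative is
  the limit of the partial sums \<open>\<Sum> 1/(z - a)\<close> over the zeros with \<open>|a| \<le> R\<close>, and this can be
  differentiated (\<open>logderiv_partial_fractions\<close>, a form of Hadamard's factorization that needs no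
  infinite products). Hence
  \<open>\<Sum> 1/(z - a)\<^sup>2 = (C\<^sub>\<nu>\<^sub>+\<^sub>1/C\<^sub>\<nu>)\<^sup>2 - C\<^sub>\<nu>\<^sub>+\<^sub>2/C\<^sub>\<nu>\<close> away from the zeros. At \<open>z = -x\<^sup>2/4\<close>, with \<open>x\<close> a zero of
  the derivative of \<open>J\<^sub>\<nu>\<^sub>+\<^sub>1\<close>, one has \<open>C\<^sub>\<nu> = (\<nu> + 1)/2 C\<^sub>\<nu>\<^sub>+\<^sub>1\<close>, so the recurrence gives
  \<open>C\<^sub>\<nu>\<^sub>+\<^sub>1/C\<^sub>\<nu> = 2/(\<nu> + 1)\<close> and \<open>C\<^sub>\<nu>\<^sub>+\<^sub>2/C\<^sub>\<nu> = -1/z\<close>; division by 16 yields the asserted value.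

  The sequences of zeros are given by a definite description, so they can be used only once each zero
  set is known to be infinite with finite initial segments. For \<open>J\<^sub>\<nu>\<close> infinitude
  follows from the partial fractions again (\<open>infinite_bessel_clifford_zeros\<close>), for the derivative
  of \<open>J\<^sub>\<nu>\<^sub>+\<^sub>1\<close> from Rolle's theorem; finiteness holds because both sets are zero sets of entire
  functions that do not vanish at 0.
\<close>

section \<open>Logarithmic derivatives of entire functions of minimal exponential type\<close>

text \<open>
  The Moebius map \<open>h \<mapsto> h / (2 A - h)\<close> takes the half-plane \<open>Re h < A\<close> to the unit disc and fixes 0,
  so the Schwarz lemma applies to the rescaled composition.
\<close>

lemma Borel_Caratheodory_half:
  assumes hol: "h holomorphic_on ball 0 R" and "h 0 = 0" and "R > 0"
    and Re: "\<And>z. norm z < R \<Longrightarrow> Re (h z) < A"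
    and z: "norm z \<le> R / 2"
  shows "norm (h z) \<le> 2 * A"
proof -
  have A: "A > 0" using Re[of 0] \<open>h 0 = 0\<close> \<open>R > 0\<close> by simp
  define \<phi> where "\<phi> w = h (of_real R * w) / (of_real (2 * A) - h (of_real R * w))" for w
  have bd: "norm (of_real R * w) < R" if "norm w < 1" for w :: complex
    using that \<open>R > 0\<close> by (simp add: norm_mult)
  have less: "norm (h w) < norm (of_real (2 * A) - h w)" if "norm w < R" for w
  proof -
    have "norm (of_real (2 * A) - h w) ^ 2 - norm (h w) ^ 2 = 4 * A * (A - Re (h w))"
      unfolding cmod_power2 by (simp add: power2_eq_square algebra_simps)
    moreover have "4 * A * (A - Re (h w)) > 0"
      using A Re[OF that] by simp
    ultimately show ?thesis
      by (metis power2_less_imp_less norm_ge_zero diff_gt_0_iff_gt)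
  qed
  have nz: "of_real (2 * A) - h w \<noteq> 0" if "norm w < R" for w
    using less[OF that] by auto
  have "(\<lambda>w. h (of_real R * w)) holomorphic_on ball 0 1"
    by (rule holomorphic_on_compose_gen[OF _ hol, unfolded o_def])
       (use bd in \<open>auto intro!: holomorphic_intros\<close>)
  then have "\<phi> holomorphic_on ball 0 1"
    unfolding \<phi>_def by (intro holomorphic_intros) (use bd nz in auto)
  moreover have "\<phi> 0 = 0" by (simp add: \<phi>_def \<open>h 0 = 0\<close>)
  moreover have "norm (\<phi> w) < 1" if "norm w < 1" for w
    using less[OF bd[OF that]] nz[OF bd[OF that]] by (simp add: \<phi>_def norm_divide)
  moreover have "norm (z / of_real R) < 1" using z \<open>R > 0\<close> by (simp add: norm_divide divide_simps)
  ultimately have "norm (\<phi> (z / of_real R)) \<le> norm (z / of_real R)"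
    using Schwarz_Lemma(1) by blast
  also have "\<dots> \<le> 1 / 2" using z \<open>R > 0\<close> by (simp add: norm_divide divide_simps)
  finally have "norm (h z) / norm (of_real (2 * A) - h z) \<le> 1 / 2"
    using \<open>R > 0\<close> by (simp add: \<phi>_def norm_divide)
  moreover have "norm (of_real (2 * A) - h z) > 0" using nz[of z] z \<open>R > 0\<close> by simp
  ultimately have "2 * norm (h z) \<le> norm (of_real (2 * A) - h z)"
    by (simp add: divide_simps)
  also have "\<dots> \<le> 2 * A + norm (h z)"
    using norm_triangle_ineq4[of "of_real (2 * A)" "h z"] A by simp
  finally show ?thesis by simp
qed

text \<open>
  The normalisation \<open>1 - z / a\<close> of the factors keeps the value at 0, and the hypothesis that the
  derivatives do not vanish is what makes the cofactor nonzero at the removed zeros.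
\<close>

lemma factor_out_simple_zeros:
  assumes "finite Z" and "f holomorphic_on UNIV" and "0 \<notin> Z"
    and "\<And>a. a \<in> Z \<Longrightarrow> f a = 0 \<and> deriv f a \<noteq> 0"
  obtains g where "g holomorphic_on UNIV" "\<And>z. f z = g z * (\<Prod>a\<in>Z. 1 - z / a)"
    "\<And>a. a \<in> Z \<Longrightarrow> g a \<noteq> 0"
proof -
  have "\<exists>g. g holomorphic_on UNIV \<and> (\<forall>z. f z = g z * (\<Prod>a\<in>Z. 1 - z / a)) \<and> (\<forall>a\<in>Z. g a \<noteq> 0)"
    using assms
  proof (induction Z)
    case empty
    then show ?case by (intro exI[of _ f]) auto
  next
    case (insert b Z)
    then obtain g where g: "g holomorphic_on UNIV" "\<And>z. f z = g z * (\<Prod>a\<in>Z. 1 - z / a)"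
      "\<And>a. a \<in> Z \<Longrightarrow> g a \<noteq> 0"
      by auto
    define P where "P z = (\<Prod>a\<in>Z. 1 - z / a)" for z
    have Pb: "P b \<noteq> 0"
      using insert.hyps insert.prems by (auto simp: P_def)
    have fb: "f b = 0" "deriv f b \<noteq> 0" and b: "b \<noteq> 0"
      using insert.prems by auto
    have gb: "g b = 0" using g(2)[of b] fb Pb by (simp add: P_def)
    have holP: "P holomorphic_on UNIV"
      unfolding P_def using insert.prems by (intro holomorphic_intros) auto
    have fd: "u field_differentiable at b" if "u holomorphic_on UNIV" for u
      using that by (simp add: holomorphic_on_def)
    have f_eq: "f = (\<lambda>z. g z * P z)" using g(2) by (auto simp: P_def)
    have "deriv f b = g b * deriv P b + deriv g b * P b"
      unfolding f_eq by (rule deriv_mult) (use g(1) holP fd in auto)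
    with gb fb have g'b: "deriv g b \<noteq> 0" by auto
    define k where "k z = (if z = b then deriv g b else g z / (z - b))" for z
    have holk: "k holomorphic_on UNIV"
      by (rule pole_theorem_0[OF g(1), of b]) (auto simp: k_def gb)
    have gk: "g z = (z - b) * k z" for z
      by (auto simp: k_def gb)
    show ?case
    proof (intro exI[of _ "\<lambda>z. - b * k z"] conjI allI ballI)
      show "(\<lambda>z. - b * k z) holomorphic_on UNIV"
        using holk by (intro holomorphic_intros)
      fix z show "f z = - b * k z * (\<Prod>a\<in>insert b Z. 1 - z / a)"
        using insert.hyps b by (simp add: g(2) gk field_simps)
    next
      fix a assume "a \<in> insert b Z"
      then show "- b * k a \<noteq> 0"
        using g(3)[of a] gb b g'b insert.hyps by (auto simp: k_def)
    qed
  qed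
  with that show ?thesis by blast
qed

lemma finite_zeros_cball:
  assumes "f holomorphic_on UNIV" and "f 0 \<noteq> (0::complex)"
  shows "finite {a. f a = 0 \<and> norm a \<le> R}"
proof (cases "f constant_on UNIV")
  case True
  then have "{a. f a = 0 \<and> norm a \<le> R} = {}"
    using assms(2) by (auto simp: constant_on_def)
  then show ?thesis by (simp only: finite.emptyI)
next
  case False
  have "finite {z \<in> cball 0 R. f z = 0}"
    by (rule holomorphic_compact_finite_zeros[OF assms(1)]) (use False in auto)
  then show ?thesis by (rule rev_finite_subset) auto
qed

text \<open>
  Removing the zeros of modulus at most \<open>R\<close> leaves an entire function without zeros in the ball of radius
  \<open>R\<close>. On the circle of radius \<open>2 R\<close> every removed factor has modulus at least 1, so by the maximum
  principle the cofactor is bounded by the maximum of \<open>f\<close> on that circle. This bounds the real part of its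
  logarithm from above, and Borel--Caratheodory turns that into a bound for the logarithm itself.
\<close>

lemma entire_eq_exp_times_zeros_on_ball:
  fixes f :: "complex \<Rightarrow> complex"
  assumes hol: "f holomorphic_on UNIV" and f0: "f 0 \<noteq> 0"
    and simple: "\<And>a. f a = 0 \<Longrightarrow> deriv f a \<noteq> 0"
    and R: "R > 0" and bound: "\<And>z. norm z = 2 * R \<Longrightarrow> norm (f z) < norm (f 0) * exp A"
  obtains h where "h holomorphic_on ball 0 R"
    "\<And>z. norm z < R \<Longrightarrow> f z = f 0 * exp (h z) * (\<Prod>a | f a = 0 \<and> norm a \<le> R. 1 - z / a)"
    "\<And>z. norm z \<le> R / 2 \<Longrightarrow> norm (h z) \<le> 2 * A"
proof -
  define Z where "Z = {a. f a = 0 \<and> norm a \<le> R}"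
  have fin: "finite Z" unfolding Z_def by (rule finite_zeros_cball[OF hol f0])
  obtain g where g: "g holomorphic_on UNIV" "\<And>z. f z = g z * (\<Prod>a\<in>Z. 1 - z / a)"
    "\<And>a. a \<in> Z \<Longrightarrow> g a \<noteq> 0"
  proof (rule factor_out_simple_zeros[OF fin hol])
    show "0 \<notin> Z" using f0 by (simp add: Z_def)
    show "f a = 0 \<and> deriv f a \<noteq> 0" if "a \<in> Z" for a
      using that simple by (simp add: Z_def)
  qed (rule that)
  have gnz: "g z \<noteq> 0" if "norm z < R" for z
  proof (cases "z \<in> Z")
    case False
    then have "f z \<noteq> 0" using that by (auto simp: Z_def)
    then show ?thesis using g(2)[of z] by auto
  qed (use g(3) in auto)
  have g0: "g 0 = f 0" using g(2)[of 0] by simp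
  have gcirc: "norm (g z) \<le> norm (f z)" if "norm z = 2 * R" for z
  proof -
    have "1 \<le> norm (1 - z / a)" if "a \<in> Z" for a
    proof -
      have "a \<noteq> 0" "norm a \<le> R" using that f0 by (auto simp: Z_def)
      then have "2 \<le> norm (z / a)" using \<open>norm z = 2 * R\<close> by (simp add: norm_divide divide_simps)
      then show ?thesis using norm_triangle_ineq3[of "z / a" 1] by (simp add: norm_minus_commute)
    qed
    then have "1 \<le> (\<Prod>a\<in>Z. norm (1 - z / a))" by (intro prod_ge_1) auto
    then have "norm (g z) * 1 \<le> norm (g z) * (\<Prod>a\<in>Z. norm (1 - z / a))"
      by (intro mult_left_mono) auto
    also have "\<dots> = norm (f z)" by (simp add: g(2) norm_mult prod_norm)
    finally show ?thesis by simp
  qed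
  have contg: "continuous_on UNIV g" using g(1) holomorphic_on_imp_continuous_on by blast
  \<comment> \<open>The maximum principle gives a weak inequality only, so the strict bound needs a maximum on the circle.\<close>
  obtain B where B: "B < norm (f 0) * exp A" "\<And>z. norm z = 2 * R \<Longrightarrow> norm (f z) \<le> B"
  proof -
    have "compact (sphere (0::complex) (2 * R))" "sphere (0::complex) (2 * R) \<noteq> {}"
      using R by auto
    moreover have "continuous_on (sphere 0 (2 * R)) (\<lambda>z. norm (f z))"
      using hol holomorphic_on_imp_continuous_on continuous_on_subset
      by (intro continuous_intros) blast
    ultimately obtain w where "w \<in> sphere 0 (2 * R)" "\<And>z. z \<in> sphere 0 (2 * R) \<Longrightarrow> norm (f z) \<le> norm (f w)"
      using continuous_attains_sup by metis
    with bound[of w] that show ?thesis by auto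
  qed
  have gB: "norm (g z) \<le> B" if "norm z < R" for z
  proof (rule maximum_modulus_frontier[of g "ball 0 (2 * R)"])
    show "norm (g w) \<le> B" if "w \<in> frontier (ball 0 (2 * R))" for w
      using that R gcirc[of w] B(2)[of w] by (auto simp: frontier_ball)
  qed (use that R in \<open>auto intro: holomorphic_on_subset[OF g(1)] continuous_on_subset[OF contg]\<close>)
  obtain h0 where h0: "h0 holomorphic_on ball 0 R" "\<And>z. z \<in> ball 0 R \<Longrightarrow> g z = exp (h0 z)"
    using contractible_imp_holomorphic_log[of g "ball 0 R"] gnz g(1)
    by (metis convex_ball convex_imp_contractible holomorphic_on_subset mem_ball_0 subset_UNIV)
  define h where "h z = h0 z - h0 0" for z
  have holh: "h holomorphic_on ball 0 R"
    unfolding h_def by (intro holomorphic_intros h0)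
  have gh: "g z = f 0 * exp (h z)" if "norm z < R" for z
    using h0(2)[of z] h0(2)[of 0] that R g0 by (simp add: h_def exp_diff)
  show ?thesis
  proof (rule that[OF holh])
    show "f z = f 0 * exp (h z) * (\<Prod>a | f a = 0 \<and> norm a \<le> R. 1 - z / a)" if "norm z < R" for z
      using g(2)[of z] gh[OF that] by (simp add: Z_def)
    have "Re (h z) < A" if "norm z < R" for z
    proof -
      have "norm (f 0) * exp (Re (h z)) \<le> B"
        using gB[OF that] gh[OF that] by (simp add: norm_mult)
      also note B(1)
      finally show ?thesis using f0 by simp
    qed
    then show "norm (h z) \<le> 2 * A" if "norm z \<le> R / 2" for z
      by (intro Borel_Caratheodory_half[OF holh _ R _ that]) (auto simp: h_def)
  qed
qed

text \<open>
  The errors are the first two derivatives of the logarithm \<open>h\<close> of the zero-free cofactor. Cauchy's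
  inequality on a circle of radius \<open>R / 4\<close> around \<open>z\<close> bounds them by means of \<open>|h| \<le> 2 A\<close>.
\<close>

lemma logderiv_approx:
  fixes f :: "complex \<Rightarrow> complex"
  assumes hol: "f holomorphic_on UNIV" and f0: "f 0 \<noteq> 0"
    and simple: "\<And>a. f a = 0 \<Longrightarrow> deriv f a \<noteq> 0"
    and R: "R > 0" and bound: "\<And>z. norm z = 2 * R \<Longrightarrow> norm (f z) < norm (f 0) * exp A"
    and z: "norm z \<le> R / 4" "f z \<noteq> 0"
  shows "norm (deriv f z / f z - (\<Sum>a | f a = 0 \<and> norm a \<le> R. 1 / (z - a))) \<le> 8 * A / R"
    and "norm (deriv (\<lambda>w. deriv f w / f w) z + (\<Sum>a | f a = 0 \<and> norm a \<le> R. 1 / (z - a)\<^sup>2))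
           \<le> 64 * A / R\<^sup>2"
proof -
  define Z where "Z = {a. f a = 0 \<and> norm a \<le> R}"
  have fin: "finite Z" unfolding Z_def by (rule finite_zeros_cball[OF hol f0])
  obtain h where h: "h holomorphic_on ball 0 R"
    "\<And>z. norm z < R \<Longrightarrow> f z = f 0 * exp (h z) * (\<Prod>a\<in>Z. 1 - z / a)"
    "\<And>z. norm z \<le> R / 2 \<Longrightarrow> norm (h z) \<le> 2 * A"
  proof (rule entire_eq_exp_times_zeros_on_ball[OF hol f0 simple R bound, folded Z_def])
  qed (assumption | rule that)+
  have log: "deriv f w / f w = deriv h w + (\<Sum>a\<in>Z. 1 / (w - a))" if w: "norm w < R" "f w \<noteq> 0" for w
  proof -
    have nz: "a \<noteq> 0" "w \<noteq> a" if "a \<in> Z" for a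
      using that f0 w by (auto simp: Z_def)
    have dh: "(h has_field_derivative deriv h w) (at w)"
      using h(1) w by (intro holomorphic_derivI[of _ "ball 0 R"]) auto
    have dP: "((\<lambda>z. \<Prod>a\<in>Z. 1 - z / a) has_field_derivative
                (\<Prod>a\<in>Z. 1 - w / a) * (\<Sum>a\<in>Z. (- 1 / a) / (1 - w / a))) (at w)"
      by (rule has_field_derivative_prod') (use nz in \<open>auto intro!: derivative_eq_intros\<close>)
    have S: "(\<Sum>a\<in>Z. (- 1 / a) / (1 - w / a)) = (\<Sum>a\<in>Z. 1 / (w - a))"
      by (rule sum.cong) (use nz in \<open>auto simp: divide_simps\<close>)
    have "((\<lambda>z. f 0 * exp (h z) * (\<Prod>a\<in>Z. 1 - z / a)) has_field_derivative
            f w * (deriv h w + (\<Sum>a\<in>Z. 1 / (w - a)))) (at w)"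
      using dh dP unfolding S
      by (auto intro!: derivative_eq_intros simp: h(2)[OF w(1)] algebra_simps)
    then have "(f has_field_derivative f w * (deriv h w + (\<Sum>a\<in>Z. 1 / (w - a)))) (at w)"
      by (rule DERIV_cong_ev[OF refl _ refl, THEN iffD1, rotated])
         (rule eventually_mono[OF eventually_nhds_in_open[of "ball 0 R"]], use w h(2) in auto)
    then show ?thesis using w by (simp add: DERIV_imp_deriv)
  qed
  have holh': "deriv h holomorphic_on ball 0 R"
    using h(1) by (rule holomorphic_deriv) simp
  have zR: "norm z < R" using z R by simp
  have ball: "ball z (R / 4) \<subseteq> ball 0 R" "cball z (R / 4) \<subseteq> ball 0 R"
    using z R by (auto simp: dist_norm) (smt (verit) norm_triangle_sub norm_minus_commute)+
  have cauchy: "norm ((deriv ^^ n) h z) \<le> fact n * (2 * A) / (R / 4) ^ n" for n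
  proof (rule Cauchy_inequality)
    show "norm (h w) \<le> 2 * A" if "norm (z - w) = R / 4" for w
      using h(3)[of w] that z norm_triangle_sub[of w z] by (simp add: norm_minus_commute)
    show "continuous_on (cball z (R / 4)) h"
      using holomorphic_on_imp_continuous_on[OF h(1)] ball(2) by (rule continuous_on_subset)
  qed (use R ball in \<open>auto intro: holomorphic_on_subset[OF h(1)]\<close>)
  show "norm (deriv f z / f z - (\<Sum>a | f a = 0 \<and> norm a \<le> R. 1 / (z - a))) \<le> 8 * A / R"
    using cauchy[of 1] log[OF zR z(2)] by (simp add: Z_def)
  have "(deriv h has_field_derivative deriv (deriv h) z) (at z)"
    using holh' zR by (intro holomorphic_derivI[of _ "ball 0 R"]) auto
  moreover have "z \<noteq> a" if "a \<in> Z" for a using that z by (auto simp: Z_def)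
  ultimately have D: "((\<lambda>w. deriv h w + (\<Sum>a\<in>Z. 1 / (w - a))) has_field_derivative
      deriv (deriv h) z + (\<Sum>a\<in>Z. - (1 / (z - a)\<^sup>2))) (at z)"
    by (auto intro!: derivative_eq_intros simp: power2_eq_square)
  have op: "open {w. norm w < R \<and> f w \<noteq> 0}"
  proof -
    have "open (ball 0 R \<inter> f -` (- {0}))"
      using hol by (intro continuous_open_preimage)
        (auto intro: continuous_on_subset holomorphic_on_imp_continuous_on)
    also have "ball 0 R \<inter> f -` (- {0}) = {w. norm w < R \<and> f w \<noteq> 0}" by auto
    finally show ?thesis .
  qed
  have "((\<lambda>w. deriv f w / f w) has_field_derivative
      deriv (deriv h) z + (\<Sum>a\<in>Z. - (1 / (z - a)\<^sup>2))) (at z)"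
    by (rule DERIV_cong_ev[OF refl _ refl, THEN iffD1, rotated, OF D])
       (rule eventually_mono[OF eventually_nhds_in_open[OF op]], use zR z log in auto)
  then have "deriv (\<lambda>w. deriv f w / f w) z + (\<Sum>a\<in>Z. 1 / (z - a)\<^sup>2) = deriv (deriv h) z"
    by (simp add: DERIV_imp_deriv sum_negf)
  then show "norm (deriv (\<lambda>w. deriv f w / f w) z + (\<Sum>a | f a = 0 \<and> norm a \<le> R. 1 / (z - a)\<^sup>2))
           \<le> 64 * A / R\<^sup>2"
    using cauchy[of 2] by (simp add: Z_def numeral_2_eq_2 power2_eq_square)
qed

text \<open>
  Minimal exponential type permits an exponent \<open>A\<close> in \<open>logderiv_approx\<close> of size \<open>o(R)\<close>, so
  both errors tend to 0.
\<close>

lemma logderiv_partial_fractions: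
  fixes f :: "complex \<Rightarrow> complex"
  assumes hol: "f holomorphic_on UNIV" and f0: "f 0 \<noteq> 0"
    and simple: "\<And>a. f a = 0 \<Longrightarrow> deriv f a \<noteq> 0"
    and type0: "\<And>e::real. e > 0 \<Longrightarrow> \<exists>K. \<forall>z. norm (f z) \<le> K * exp (e * norm z)"
    and z: "f z \<noteq> 0"
  shows "((\<lambda>R. \<Sum>a | f a = 0 \<and> norm a \<le> R. 1 / (z - a)) \<longlongrightarrow> deriv f z / f z) at_top"
    and "((\<lambda>R. \<Sum>a | f a = 0 \<and> norm a \<le> R. 1 / (z - a)\<^sup>2)
            \<longlongrightarrow> - deriv (\<lambda>w. deriv f w / f w) z) at_top"
proof -
  have ex: "\<exists>A. \<forall>\<^sub>F R in at_top. A R / R < e \<and> (\<forall>z. norm z = 2 * R \<longrightarrow> norm (f z) < norm (f 0) * exp (A R))"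
    if "e > 0" for e :: real
  proof -
    have "e / 4 > 0" using that by simp
    then obtain K where K: "\<And>z. norm (f z) \<le> K * exp (e / 4 * norm z)" using type0 by blast
    have "norm (f 0) \<le> K" using K[of 0] by simp
    then have K0: "K > 0" using f0 by (smt (verit) zero_less_norm_iff)
    \<comment> \<open>The added 1 makes the bound on circles strict.\<close>
    define c where "c = ln (K / norm (f 0)) + 1"
    define A where "A R = c + e / 2 * R" for R
    have "norm (f 0) * exp c = K * exp 1"
      using K0 f0 by (simp add: c_def exp_add)
    then have *: "norm (f 0) * exp (A R) = K * exp 1 * exp (e / 2 * R)" for R
      by (simp add: A_def exp_add)
    have "norm (f z) < norm (f 0) * exp (A R)" if "norm z = 2 * R" for z R
    proof -
      have "norm (f z) \<le> K * exp (e / 2 * R)" using K[of z] that by (simp add: mult.commute)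
      also have "\<dots> < K * exp 1 * exp (e / 2 * R)" using K0 by simp
      finally show ?thesis by (simp add: *)
    qed
    moreover have "\<forall>\<^sub>F R in at_top. A R / R < e"
    proof -
      have "((\<lambda>R. c / R + e / 2) \<longlongrightarrow> 0 + e / 2) at_top"
        by (intro tendsto_intros tendsto_divide_0[OF tendsto_const] filterlim_at_top_imp_at_infinity filterlim_ident)
      from order_tendstoD(2)[OF this, of e] have "\<forall>\<^sub>F R in at_top. c / R + e / 2 < e"
        using \<open>e > 0\<close> by simp
      then show ?thesis
        using eventually_gt_at_top[of 0] by eventually_elim (auto simp: A_def field_simps)
    qed
    ultimately show ?thesis by (auto intro!: exI[of _ A])
  qed
  show "((\<lambda>R. \<Sum>a | f a = 0 \<and> norm a \<le> R. 1 / (z - a)) \<longlongrightarrow> deriv f z / f z) at_top"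
  proof (rule tendstoI)
    fix e :: real assume "e > 0"
    then have "e / 8 > 0" by simp
    from ex[OF this] obtain A where
      "\<forall>\<^sub>F R in at_top. A R / R < e / 8 \<and> (\<forall>z. norm z = 2 * R \<longrightarrow> norm (f z) < norm (f 0) * exp (A R))" by blast
    then show "\<forall>\<^sub>F R in at_top. dist (\<Sum>a | f a = 0 \<and> norm a \<le> R. 1 / (z - a)) (deriv f z / f z) < e"
      using eventually_gt_at_top[of 0] eventually_ge_at_top[of "4 * norm z"]
    proof eventually_elim
      case (elim R)
      then have "norm (deriv f z / f z - (\<Sum>a | f a = 0 \<and> norm a \<le> R. 1 / (z - a))) \<le> 8 * A R / R"
        by (intro logderiv_approx(1)[OF hol f0 simple]) (use z in auto)
      also have "\<dots> = 8 * (A R / R)" by simp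
      also have "\<dots> < e" using elim by linarith
      finally show ?case by (simp add: dist_norm norm_minus_commute)
    qed
  qed
  show "((\<lambda>R. \<Sum>a | f a = 0 \<and> norm a \<le> R. 1 / (z - a)\<^sup>2)
            \<longlongrightarrow> - deriv (\<lambda>w. deriv f w / f w) z) at_top"
  proof (rule tendstoI)
    fix e :: real assume "e > 0"
    then have "e / 64 > 0" by simp
    from ex[OF this] obtain A where
      "\<forall>\<^sub>F R in at_top. A R / R < e / 64 \<and> (\<forall>z. norm z = 2 * R \<longrightarrow> norm (f z) < norm (f 0) * exp (A R))" by blast
    then show "\<forall>\<^sub>F R in at_top. dist (\<Sum>a | f a = 0 \<and> norm a \<le> R. 1 / (z - a)\<^sup>2) (- deriv (\<lambda>w. deriv f w / f w) z) < e"
      using eventually_ge_at_top[of 1] eventually_ge_at_top[of "4 * norm z"]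
    proof eventually_elim
      case (elim R)
      have "norm (deriv (\<lambda>w. deriv f w / f w) z + (\<Sum>a | f a = 0 \<and> norm a \<le> R. 1 / (z - a)\<^sup>2)) \<le> 64 * A R / R\<^sup>2"
        by (intro logderiv_approx(2)[OF hol f0 simple]) (use z elim in auto)
      also have "64 * A R / R\<^sup>2 < e / R"
      proof -
        have "A R < e / 64 * R" using elim by (auto simp: divide_simps)
        then show ?thesis using elim by (simp add: divide_simps power2_eq_square)
      qed
      also have "\<dots> \<le> e / 1" using elim \<open>e > 0\<close> by (intro divide_left_mono) auto
      finally show ?case by (simp add: dist_norm add.commute)
    qed
  qed
qed

section \<open>The Bessel--Clifford functions\<close>

definition bc_coeff :: "real \<Rightarrow> nat \<Rightarrow> real" where
  "bc_coeff \<nu> m = 1 / (fact m * Gamma (real m + \<nu> + 1))"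

definition bessel_clifford :: "real \<Rightarrow> 'a \<Rightarrow> 'a::{real_normed_field,banach}" where
  "bessel_clifford \<nu> z = (\<Sum>m. of_real (bc_coeff \<nu> m) * z ^ m)"

lemma bc_coeff_pos: "\<nu> > -1 \<Longrightarrow> bc_coeff \<nu> m > 0"
  by (simp add: bc_coeff_def Gamma_real_pos)

text \<open>
  Since \<open>(1/e)\<^sup>m / \<Gamma>(m + \<nu> + 1)\<close> is a null sequence for each \<open>e > 0\<close>, the coefficients are dominated by those
  of \<open>K exp (e z)\<close>. This gives both the convergence of the series and the growth bound.
\<close>

lemma bc_coeff_bound:
  assumes \<nu>: "\<nu> > -1" and e: "e > 0"
  obtains K where "\<And>m. bc_coeff \<nu> m \<le> K * (e ^ m / fact m)"
proof -
  define f where "f m = (1 / e) ^ m / Gamma (real m + \<nu> + 1)" for m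
  obtain N :: nat where N: "real N > 2 / e" using reals_Archimedean2 by blast
  have "summable f"
  proof (rule summable_ratio_test[of "1/2" "Suc N"])
    fix m assume m: "m \<ge> Suc N"
    have g: "real m + \<nu> + 1 > 2 / e" using N \<nu> m by linarith
    have pos: "real m + \<nu> + 1 > 0" using \<nu> by linarith
    have "Gamma (real (Suc m) + \<nu> + 1) = (real m + \<nu> + 1) * Gamma (real m + \<nu> + 1)"
      using Gamma_plus1[of "real m + \<nu> + 1"] pos
      by (simp add: add_ac) (metis add_pos_nonneg nonpos_Ints_nonpos not_less)
    then have step: "f (Suc m) = (1 / e) / (real m + \<nu> + 1) * f m"
      using pos by (simp add: f_def)
    define q where "q = (1 / e) / (real m + \<nu> + 1)"
    have q: "0 \<le> q" "q \<le> 1 / 2" using g pos e by (simp_all add: q_def field_simps)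
    have "f m \<ge> 0" using pos e by (simp add: f_def Gamma_real_pos less_imp_le)
    with q have "q * f m \<le> 1 / 2 * f m" by (intro mult_right_mono)
    then show "norm (f (Suc m)) \<le> 1 / 2 * norm (f m)"
      using q \<open>f m \<ge> 0\<close> unfolding step q_def[symmetric] by simp
  qed simp
  then have "Bseq f" by (intro convergent_imp_Bseq) (auto dest: summable_LIMSEQ_zero simp: convergent_def)
  then obtain K where K: "\<And>m. norm (f m) \<le> K" by (auto simp: Bseq_def)
  have "bc_coeff \<nu> m \<le> K * (e ^ m / fact m)" for m
  proof -
    have "bc_coeff \<nu> m = f m * (e ^ m / fact m)"
      using e by (simp add: bc_coeff_def f_def field_simps)
    also have "\<dots> \<le> K * (e ^ m / fact m)"
      using K[of m] e by (intro mult_right_mono) auto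
    finally show ?thesis .
  qed
  with that show ?thesis by blast
qed

lemma bc_summable_norm:
  fixes z :: "'a::{real_normed_field,banach}"
  assumes \<nu>: "\<nu> > -1"
  shows "summable (\<lambda>m. norm (of_real (bc_coeff \<nu> m) * z ^ m))"
proof -
  obtain K where K: "\<And>m. bc_coeff \<nu> m \<le> K * (1 ^ m / fact m)"
    using bc_coeff_bound[OF \<nu> zero_less_one] by blast
  have "summable (\<lambda>m. K * (norm z ^ m /\<^sub>R fact m))"
    by (intro summable_mult summable_exp_generic)
  then show ?thesis
  proof (rule summable_comparison_test[rotated], intro exI allI impI)
    fix m
    show "norm (norm (of_real (bc_coeff \<nu> m) * z ^ m)) \<le> K * (norm z ^ m /\<^sub>R fact m)"
      using mult_right_mono[OF K[of m], of "norm z ^ m"] bc_coeff_pos[OF \<nu>, of m]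
      by (simp add: norm_mult norm_power field_simps)
  qed
qed

lemma bc_sums:
  fixes z :: "'a::{real_normed_field,banach}"
  assumes "\<nu> > -1"
  shows "(\<lambda>m. of_real (bc_coeff \<nu> m) * z ^ m) sums bessel_clifford \<nu> z"
  unfolding bessel_clifford_def
  by (rule summable_sums[OF summable_norm_cancel[OF bc_summable_norm[OF assms]]])

lemma bessel_clifford_type:
  assumes \<nu>: "\<nu> > -1" and e: "e > 0"
  shows "\<exists>K. \<forall>z::complex. norm (bessel_clifford \<nu> z) \<le> K * exp (e * norm z)"
proof -
  obtain K where K: "\<And>m. bc_coeff \<nu> m \<le> K * (e ^ m / fact m)"
    using bc_coeff_bound[OF \<nu> e] by blast
  have "norm (bessel_clifford \<nu> z) \<le> K * exp (e * norm z)" for z :: complex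
  proof -
    have ex: "(\<lambda>m. K * ((e * norm z) ^ m /\<^sub>R fact m)) sums (K * exp (e * norm z))"
      by (intro sums_mult exp_converges)
    have "norm (bessel_clifford \<nu> z) \<le> (\<Sum>m. norm (of_real (bc_coeff \<nu> m) * z ^ m))"
      unfolding bessel_clifford_def by (rule summable_norm[OF bc_summable_norm[OF \<nu>]])
    also have "\<dots> \<le> (\<Sum>m. K * ((e * norm z) ^ m /\<^sub>R fact m))"
    proof (rule suminf_le[OF _ bc_summable_norm[OF \<nu>] sums_summable[OF ex]])
      fix m
      show "norm (of_real (bc_coeff \<nu> m) * z ^ m) \<le> K * ((e * norm z) ^ m /\<^sub>R fact m)"
        using mult_right_mono[OF K[of m], of "norm z ^ m"] bc_coeff_pos[OF \<nu>, of m]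
        by (simp add: norm_mult norm_power field_simps power_mult_distrib)
    qed
    also have "\<dots> = K * exp (e * norm z)" using ex by (rule sums_unique[symmetric])
    finally show ?thesis .
  qed
  then show ?thesis by blast
qed

lemma bessel_clifford_0: "bessel_clifford \<nu> 0 = of_real (1 / Gamma (\<nu> + 1))"
  unfolding bessel_clifford_def powser_zero by (simp add: bc_coeff_def)

lemma bessel_clifford_of_real:
  assumes "\<nu> > -1"
  shows "bessel_clifford \<nu> (of_real x :: 'a::{real_normed_field,banach}) = of_real (bessel_clifford \<nu> x)"
proof (rule sums_unique2[OF bc_sums[OF assms]])
  show "(\<lambda>m. of_real (bc_coeff \<nu> m) * of_real x ^ m :: 'a) sums of_real (bessel_clifford \<nu> x)"
    using sums_of_real[OF bc_sums[OF assms, of x], where ?'a = 'a] by simp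
qed

lemma bessel_clifford_ge_term:
  fixes x :: real
  assumes \<nu>: "\<nu> > -1" and x: "x \<ge> 0"
  shows "bc_coeff \<nu> m * x ^ m \<le> bessel_clifford \<nu> x"
proof -
  have "(\<Sum>i\<in>{m}. bc_coeff \<nu> i * x ^ i) \<le> (\<Sum>i. bc_coeff \<nu> i * x ^ i)"
    using sums_summable[OF bc_sums[OF \<nu>, of x]] x
    by (intro sum_le_suminf mult_nonneg_nonneg less_imp_le[OF bc_coeff_pos[OF \<nu>]]) auto
  then show ?thesis by (simp add: bessel_clifford_def)
qed

lemma bessel_clifford_pos:
  assumes "\<nu> > -1" and "x \<ge> (0::real)"
  shows "bessel_clifford \<nu> x > 0"
  using bessel_clifford_ge_term[OF assms, of 0] bc_coeff_pos[OF assms(1), of 0] by simp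

lemma bessel_clifford_DERIV:
  fixes z :: "'a::{real_normed_field,banach}"
  assumes "\<nu> > -1"
  shows "(bessel_clifford \<nu> has_field_derivative bessel_clifford (\<nu> + 1) z) (at z)"
proof -
  have "((\<lambda>x::'a. \<Sum>m. of_real (bc_coeff \<nu> m) * x ^ m) has_field_derivative
           (\<Sum>m. diffs (\<lambda>m. of_real (bc_coeff \<nu> m)) m * z ^ m)) (at z)"
    by (rule termdiffs_strong_converges_everywhere) (rule sums_summable[OF bc_sums[OF assms]])
  moreover have "diffs (\<lambda>m. of_real (bc_coeff \<nu> m) :: 'a) m = of_real (bc_coeff (\<nu> + 1) m)" for m
  proof -
    have "real (Suc m) * bc_coeff \<nu> (Suc m) = bc_coeff (\<nu> + 1) m"
      by (simp add: bc_coeff_def add_ac del: of_nat_Suc) (simp add: add_ac)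
    then show ?thesis by (metis diffs_def of_real_mult of_real_of_nat_eq)
  qed
  ultimately show ?thesis by (simp add: bessel_clifford_def[abs_def])
qed

text \<open>
  As \<open>C\<^sub>\<nu>' = C\<^sub>\<nu>\<^sub>+\<^sub>1\<close>, this is the differential equation \<open>z C'' + (\<nu> + 1) C' = C\<close>.
\<close>

lemma bessel_clifford_recurrence:
  fixes z :: "'a::{real_normed_field,banach}"
  assumes \<nu>: "\<nu> > -1"
  shows "bessel_clifford \<nu> z = of_real (\<nu> + 1) * bessel_clifford (\<nu> + 1) z + z * bessel_clifford (\<nu> + 2) z"
proof -
  define d where "d m = real m / (fact m * Gamma (real m + \<nu> + 2))" for m
  have dS: "d (Suc m) = bc_coeff (\<nu> + 2) m" for m
    by (simp add: d_def bc_coeff_def add_ac del: of_nat_Suc) (simp add: add_ac)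
  have "(\<lambda>m. z * (of_real (bc_coeff (\<nu> + 2) m) * z ^ m)) sums (z * bessel_clifford (\<nu> + 2) z)"
    using \<nu> by (intro sums_mult bc_sums) simp
  then have "(\<lambda>m. of_real (d (Suc m)) * z ^ Suc m) sums (z * bessel_clifford (\<nu> + 2) z)"
    by (simp add: dS mult_ac)
  then have 1: "(\<lambda>m. of_real (d m) * z ^ m) sums (z * bessel_clifford (\<nu> + 2) z)"
    by (subst (asm) sums_Suc_iff) (simp add: d_def)
  have 2: "(\<lambda>m. of_real (\<nu> + 1) * (of_real (bc_coeff (\<nu> + 1) m) * z ^ m)) sums
          (of_real (\<nu> + 1) * bessel_clifford (\<nu> + 1) z)"
    using \<nu> by (intro sums_mult bc_sums) simp
  have coeff: "(\<nu> + 1) * bc_coeff (\<nu> + 1) m + d m = bc_coeff \<nu> m" for m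
  proof -
    have pos: "real m + \<nu> + 1 > 0" using \<nu> by linarith
    have "Gamma (real m + \<nu> + 2) = (real m + \<nu> + 1) * Gamma (real m + \<nu> + 1)"
      using Gamma_plus1[of "real m + \<nu> + 1"] pos
      by (simp add: add_ac) (metis add_pos_nonneg nonpos_Ints_nonpos not_less)
    then have "(\<nu> + 1) * bc_coeff (\<nu> + 1) m + d m
        = (real m + \<nu> + 1) / (fact m * ((real m + \<nu> + 1) * Gamma (real m + \<nu> + 1)))"
      by (simp add: bc_coeff_def d_def add_divide_distrib add_ac)
    also have "\<dots> = bc_coeff \<nu> m"
      using pos by (simp add: bc_coeff_def)
    finally show ?thesis .
  qed
  have "(\<lambda>m. of_real (bc_coeff \<nu> m) * z ^ m) sums
          (of_real (\<nu> + 1) * bessel_clifford (\<nu> + 1) z + z * bessel_clifford (\<nu> + 2) z)"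
    using sums_add[OF 2 1] unfolding coeff[symmetric]
    by (simp add: algebra_simps)
  then show ?thesis by (rule sums_unique2[OF bc_sums[OF \<nu>]])
qed

lemma bessel_clifford_holomorphic:
  assumes "\<nu> > -1"
  shows "bessel_clifford \<nu> holomorphic_on S"
  unfolding holomorphic_on_def field_differentiable_def
  using bessel_clifford_DERIV[OF assms] has_field_derivative_at_within by blast

lemma deriv_bessel_clifford: "\<nu> > -1 \<Longrightarrow> deriv (bessel_clifford \<nu>) = bessel_clifford (\<nu> + 1)"
  by (rule ext, rule DERIV_imp_deriv, rule bessel_clifford_DERIV)

lemma bessel_clifford_0_nonzero: "\<nu> > -1 \<Longrightarrow> bessel_clifford \<nu> 0 \<noteq> 0"
  using less_imp_neq[OF Gamma_real_pos[of "\<nu> + 1"]] by (simp add: bessel_clifford_0)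

section \<open>The zeros of the Bessel--Clifford functions\<close>

text \<open>
  At a common zero of \<open>C\<^sub>\<nu>\<close> and \<open>C\<^sub>\<nu>\<^sub>+\<^sub>1\<close> the recurrence forces all \<open>C\<^sub>\<nu>\<^sub>+\<^sub>k\<close>, hence all derivatives of \<open>C\<^sub>\<nu>\<close>,
  to vanish.
\<close>

lemma bessel_clifford_simple_zero:
  fixes a :: complex
  assumes \<nu>: "\<nu> > -1" and a: "bessel_clifford \<nu> a = 0"
  shows "bessel_clifford (\<nu> + 1) a \<noteq> 0"
proof
  assume 1: "bessel_clifford (\<nu> + 1) a = 0"
  have a0: "a \<noteq> 0" using a bessel_clifford_0_nonzero[OF \<nu>] by auto
  have "bessel_clifford (\<nu> + real k) a = 0 \<and> bessel_clifford (\<nu> + real k + 1) a = 0" for k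
  proof (induction k)
    case (Suc k)
    have "\<nu> + real k > -1" using \<nu> by simp
    from bessel_clifford_recurrence[OF this, of a] Suc a0
    show ?case by (simp add: add_ac)
  qed (use a 1 in simp)
  moreover have "(deriv ^^ k) (bessel_clifford \<nu>) = (bessel_clifford (\<nu> + real k) :: complex \<Rightarrow> complex)" for k
  proof (induction k)
    case (Suc k)
    have "\<nu> + real k > -1" using \<nu> by simp
    with Suc deriv_bessel_clifford[OF this] show ?case by (simp add: add_ac)
  qed simp
  ultimately have "(deriv ^^ k) (bessel_clifford \<nu>) a = 0" for k by simp
  then have "bessel_clifford \<nu> (0::complex) = 0"
    using holomorphic_fun_eq_0_on_connected[OF bessel_clifford_holomorphic[OF \<nu>, of UNIV], of a 0] connected_UNIV by simp
  then show False using bessel_clifford_0_nonzero[OF \<nu>] by blast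
qed

text \<open>
  For \<open>u(t) = C\<^sub>\<nu>(a t)\<close> the differential equation reads \<open>(t\<^sup>\<nu>\<^sup>+\<^sup>1 u')' = a t\<^sup>\<nu> u\<close>, so
  \<open>G = t\<^sup>\<nu>\<^sup>+\<^sup>1 Im (u' cnj u)\<close> has derivative \<open>Im a t\<^sup>\<nu> |u|\<^sup>2\<close>. It vanishes at 0 (as \<open>\<nu> > -1\<close>) and at the first
  zero \<open>s\<close> of \<open>u\<close>; by Rolle's theorem \<open>u\<close> would vanish before \<open>s\<close> if \<open>Im a\<close> were nonzero.
\<close>

lemma bessel_clifford_zero_real:
  fixes a :: complex
  assumes \<nu>: "\<nu> > -1" and a: "bessel_clifford \<nu> a = 0"
  shows "Im a = 0"
proof (rule ccontr)
  assume im: "Im a \<noteq> 0"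
  define u where "u t = bessel_clifford \<nu> (a * of_real t)" for t :: real
  define v where "v t = bessel_clifford (\<nu> + 1) (a * of_real t)" for t :: real
  define w where "w t = bessel_clifford (\<nu> + 2) (a * of_real t)" for t :: real
  have chain: "((\<lambda>t. bessel_clifford \<mu> (a * of_real t)) has_vector_derivative
                 a * bessel_clifford (\<mu> + 1) (a * of_real t)) (at t)" if "\<mu> > -1" for \<mu> t
  proof -
    have "((\<lambda>z. bessel_clifford \<mu> (a * z)) has_field_derivative
                 bessel_clifford (\<mu> + 1) (a * of_real t) * a) (at (of_real t))"
      by (rule DERIV_chain2[OF bessel_clifford_DERIV[OF that]]) (auto intro!: derivative_eq_intros)
    from has_vector_derivative_real_field[OF this] show ?thesis by (simp add: mult.commute)
  qed
  have du: "(u has_vector_derivative a * v t) (at t)" for t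
    unfolding u_def v_def using chain[OF \<nu>] .
  have dv: "(v has_vector_derivative a * w t) (at t)" for t
    unfolding v_def w_def using chain[of "\<nu> + 1" t] \<nu> by (simp add: add.assoc)
  have contu: "continuous_on UNIV u" and contv: "continuous_on UNIV v"
    using du dv by (auto intro!: continuous_at_imp_continuous_on has_vector_derivative_continuous)
  have rec: "u t = of_real (\<nu> + 1) * v t + a * of_real t * w t" for t
    unfolding u_def v_def w_def by (rule bessel_clifford_recurrence[OF \<nu>])
  have u0: "u 0 \<noteq> 0" using bessel_clifford_0_nonzero[OF \<nu>] by (simp add: u_def)
  obtain s where s: "s \<in> {0..1}" "u s = 0" "\<And>t. 0 \<le> t \<Longrightarrow> t < s \<Longrightarrow> u t \<noteq> 0"
  proof -
    have "closed ({0..1} \<inter> u -` {0})"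
      by (intro continuous_closed_preimage continuous_on_subset[OF contu]) auto
    then have "compact ({0..1} \<inter> ({0..1} \<inter> u -` {0}))"
      by (intro compact_Int_closed) auto
    moreover have "1 \<in> {0..1} \<inter> ({0..1} \<inter> u -` {0})" using a by (simp add: u_def)
    ultimately obtain s where "s \<in> {0..1} \<inter> ({0..1} \<inter> u -` {0})"
      "\<And>t. t \<in> {0..1} \<inter> ({0..1} \<inter> u -` {0}) \<Longrightarrow> s \<le> t"
      using compact_attains_inf by (metis empty_iff)
    then show ?thesis by (intro that[of s]) force+
  qed
  have s0: "s > 0" using s u0 by (cases "s = 0") auto
  define G where "G t = t powr (\<nu> + 1) * Im (a * v t * cnj (u t))" for t
  have contG: "continuous_on {0..s} G"
    unfolding G_def using \<nu>
    by (intro continuous_intros continuous_on_powr' continuous_on_subset[OF contu] continuous_on_subset[OF contv]) auto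
  have dG: "(G has_real_derivative t powr \<nu> * (Im a * (norm (u t))\<^sup>2)) (at t)" if t: "t > 0" for t
  proof -
    define I where "I t = Im (a * v t * cnj (u t))" for t
    have "((\<lambda>t. a * v t * cnj (u t)) has_vector_derivative
             a * (a * w t) * cnj (u t) + a * v t * cnj (a * v t)) (at t)"
      using du[of t] dv[of t]
      by (auto intro!: derivative_eq_intros has_vector_derivative_mult has_vector_derivative_cnj)
    from bounded_linear.has_vector_derivative[OF bounded_linear_Im this]
    have "(I has_real_derivative Im (a * (a * w t) * cnj (u t) + a * v t * cnj (a * v t))) (at t)"
      unfolding I_def[abs_def] has_real_derivative_iff_has_vector_derivative .
    also have "Im (a * (a * w t) * cnj (u t) + a * v t * cnj (a * v t)) = Im (a * (a * w t) * cnj (u t))"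
      by (simp only: complex_norm_square[symmetric] plus_complex.sel Im_complex_of_real)
    finally have dI: "(I has_real_derivative Im (a * (a * w t) * cnj (u t))) (at t)" .
    have "((\<lambda>t. t powr (\<nu> + 1) * I t) has_real_derivative
            (\<nu> + 1) * t powr \<nu> * I t + Im (a * (a * w t) * cnj (u t)) * t powr (\<nu> + 1)) (at t)"
      using t by (auto intro!: derivative_eq_intros dI)
    also have "(\<nu> + 1) * t powr \<nu> * I t + Im (a * (a * w t) * cnj (u t)) * t powr (\<nu> + 1)
        = t powr \<nu> * Im (a * cnj (u t) * (of_real (\<nu> + 1) * v t + a * of_real t * w t))"
      using t by (simp add: I_def powr_add algebra_simps)
    also have "\<dots> = t powr \<nu> * Im (a * (u t * cnj (u t)))"
      unfolding rec[symmetric] by (simp add: mult_ac)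
    also have "\<dots> = t powr \<nu> * (Im a * (norm (u t))\<^sup>2)"
      by (simp only: complex_norm_square[symmetric]) simp
    finally show ?thesis by (simp add: G_def[abs_def] I_def)
  qed
  have "\<exists>z. 0 < z \<and> z < s \<and> (*) (z powr \<nu> * (Im a * (norm (u z))\<^sup>2)) = (\<lambda>v. 0)"
  proof (rule Rolle_deriv[OF s0 _ contG])
    show "G 0 = G s" using \<nu> s by (simp add: G_def)
  qed (rule dG[unfolded has_field_derivative_def])
  then obtain t where t: "0 < t" "t < s" "(*) (t powr \<nu> * (Im a * (norm (u t))\<^sup>2)) = (\<lambda>v. 0)" by blast
  from fun_cong[OF t(3), of 1] have "t powr \<nu> * (Im a * (norm (u t))\<^sup>2) = 0" by simp
  then have "u t = 0" using t(1) im by simp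
  then show False using s(3)[of t] t by simp
qed

lemma bessel_clifford_zero_neg:
  fixes a :: complex
  assumes \<nu>: "\<nu> > -1" and a: "bessel_clifford \<nu> a = 0"
  shows "a = of_real (Re a)" and "Re a < 0"
proof -
  show r: "a = of_real (Re a)"
    using bessel_clifford_zero_real[OF assms] by (simp add: complex_eq_iff)
  have "bessel_clifford \<nu> (Re a) = 0"
    using a bessel_clifford_of_real[OF \<nu>, of "Re a", where ?'a = complex] r by simp
  then show "Re a < 0" using bessel_clifford_pos[OF \<nu>, of "Re a"] by force
qed

lemma bessel_clifford_logderiv:
  fixes z :: complex
  assumes \<nu>: "\<nu> > -1" and z: "bessel_clifford \<nu> z \<noteq> 0"
  shows "((\<lambda>R. \<Sum>a | bessel_clifford \<nu> a = 0 \<and> norm a \<le> R. 1 / (z - a))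
            \<longlongrightarrow> bessel_clifford (\<nu> + 1) z / bessel_clifford \<nu> z) at_top"
    and "((\<lambda>R. \<Sum>a | bessel_clifford \<nu> a = 0 \<and> norm a \<le> R. 1 / (z - a)\<^sup>2)
            \<longlongrightarrow> (bessel_clifford (\<nu> + 1) z / bessel_clifford \<nu> z)\<^sup>2
                 - bessel_clifford (\<nu> + 2) z / bessel_clifford \<nu> z) at_top"
proof -
  have simple: "deriv (bessel_clifford \<nu>) a \<noteq> 0" if "bessel_clifford \<nu> a = 0" for a :: complex
    using bessel_clifford_simple_zero[OF \<nu> that] by (simp add: deriv_bessel_clifford[OF \<nu>])
  note * = logderiv_partial_fractions[OF bessel_clifford_holomorphic[OF \<nu>]
      bessel_clifford_0_nonzero[OF \<nu>] simple bessel_clifford_type[OF \<nu>] z,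
      unfolded deriv_bessel_clifford[OF \<nu>]]
  show "((\<lambda>R. \<Sum>a | bessel_clifford \<nu> a = 0 \<and> norm a \<le> R. 1 / (z - a))
            \<longlongrightarrow> bessel_clifford (\<nu> + 1) z / bessel_clifford \<nu> z) at_top"
    by (rule *(1)) auto
  have "\<nu> + 1 > -1" using \<nu> by simp
  from bessel_clifford_DERIV[OF this, of z]
  have "(bessel_clifford (\<nu> + 1) has_field_derivative bessel_clifford (\<nu> + 2) z) (at z)"
    by (simp add: add.assoc)
  from DERIV_divide[OF this bessel_clifford_DERIV[OF \<nu>] z]
  have "deriv (\<lambda>w. bessel_clifford (\<nu> + 1) w / bessel_clifford \<nu> w) z =
      (bessel_clifford (\<nu> + 2) z * bessel_clifford \<nu> z - bessel_clifford (\<nu> + 1) z * bessel_clifford (\<nu> + 1) z)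
        / (bessel_clifford \<nu> z * bessel_clifford \<nu> z)"
    by (rule DERIV_imp_deriv)
  also have "\<dots> = - ((bessel_clifford (\<nu> + 1) z / bessel_clifford \<nu> z)\<^sup>2
                 - bessel_clifford (\<nu> + 2) z / bessel_clifford \<nu> z)"
    using z by (simp add: diff_divide_distrib power2_eq_square)
  finally have D: "- deriv (\<lambda>w. bessel_clifford (\<nu> + 1) w / bessel_clifford \<nu> w) z =
      (bessel_clifford (\<nu> + 1) z / bessel_clifford \<nu> z)\<^sup>2
                 - bessel_clifford (\<nu> + 2) z / bessel_clifford \<nu> z" by simp
  show "((\<lambda>R. \<Sum>a | bessel_clifford \<nu> a = 0 \<and> norm a \<le> R. 1 / (z - a)\<^sup>2)
            \<longlongrightarrow> (bessel_clifford (\<nu> + 1) z / bessel_clifford \<nu> z)\<^sup>2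
                 - bessel_clifford (\<nu> + 2) z / bessel_clifford \<nu> z) at_top"
    unfolding D[symmetric] by (rule *(2)) auto
qed

text \<open>
  With only \<open>N\<close> zeros, all negative, the partial fractions give \<open>C'/C \<le> N/x\<close> for \<open>x > 0\<close>. Then
  \<open>C(x) / x\<^sup>N\<close> is nonincreasing, whereas the term of degree \<open>N + 1\<close> of the series makes it grow at least linearly.
\<close>

lemma infinite_bessel_clifford_zeros:
  assumes \<nu>: "\<nu> > -1"
  shows "infinite {a::complex. bessel_clifford \<nu> a = 0}"
proof
  define Z where "Z = {a::complex. bessel_clifford \<nu> a = 0}"
  assume "finite {a::complex. bessel_clifford \<nu> a = 0}"
  then have fin: "finite Z" by (simp add: Z_def)
  define N where "N = card Z"
  define D where "D x = bessel_clifford \<nu> x" for x :: real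
  define D' where "D' x = bessel_clifford (\<nu> + 1) x" for x :: real
  have pos: "D x > 0" if "x \<ge> 0" for x
    using bessel_clifford_pos[OF \<nu> that] by (simp add: D_def)
  have growth: "x * D' x \<le> N * D x" if x: "x > 0" for x
  proof -
    have nz: "bessel_clifford \<nu> (of_real x :: complex) \<noteq> 0"
      using pos[of x] x bessel_clifford_of_real[OF \<nu>, of x, where ?'a = complex] by (simp add: D_def)
    obtain B where B: "\<And>a. a \<in> Z \<Longrightarrow> norm a \<le> B"
      using finite_imp_bounded[OF fin] by (auto simp: bounded_iff)
    have "\<forall>\<^sub>F R in at_top. (\<Sum>a | bessel_clifford \<nu> a = 0 \<and> norm a \<le> R. 1 / (of_real x - a)) = (\<Sum>a\<in>Z. 1 / (of_real x - a))"
      using eventually_ge_at_top[of B]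
    proof eventually_elim
      case (elim R)
      have "{a. bessel_clifford \<nu> a = 0 \<and> norm a \<le> R} = Z"
        using B elim by (force simp: Z_def)
      then show ?case by simp
    qed
    then have "((\<lambda>R. \<Sum>a | bessel_clifford \<nu> a = 0 \<and> norm a \<le> R. 1 / (of_real x - a)) \<longlongrightarrow> (\<Sum>a\<in>Z. 1 / (of_real x - a))) at_top"
      by (rule tendsto_eventually)
    from tendsto_unique[OF _ bessel_clifford_logderiv(1)[OF \<nu> nz] this]
    have "bessel_clifford (\<nu> + 1) (of_real x) / bessel_clifford \<nu> (of_real x) = (\<Sum>a\<in>Z. 1 / (of_real x - a :: complex))"
      by simp
    also have "bessel_clifford (\<nu> + 1) (of_real x) / bessel_clifford \<nu> (of_real x) = (of_real (D' x / D x) :: complex)"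
      using \<nu> by (simp add: bessel_clifford_of_real D_def D'_def)
    finally have "\<bar>D' x / D x\<bar> = norm (\<Sum>a\<in>Z. 1 / (of_real x - a :: complex))"
      by (metis norm_of_real)
    also have "\<dots> \<le> (\<Sum>a\<in>Z. 1 / x)"
    proof (rule sum_norm_le)
      fix a assume "a \<in> Z"
      then have a: "a = of_real (Re a)" "Re a < 0"
        using bessel_clifford_zero_neg[OF \<nu>, of a] by (auto simp: Z_def)
      have "norm (of_real x - a) = \<bar>x - Re a\<bar>" by (metis a(1) norm_of_real of_real_diff)
      then have "norm (of_real x - a) \<ge> x" using a x by simp
      then show "norm (1 / (of_real x - a)) \<le> 1 / x" using x by (simp add: norm_divide frac_le)
    qed
    also have "\<dots> = N / x" by (simp add: N_def)
    finally have "D' x / D x \<le> N / x" by (rule order.trans[OF abs_ge_self])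
    then show ?thesis using x pos[of x] by (simp add: field_simps)
  qed
  have mono: "D x / x ^ N \<le> D 1" if x: "x \<ge> 1" for x
  proof -
    have "D x / x ^ N \<le> D 1 / 1 ^ N"
    proof (rule DERIV_nonpos_imp_nonincreasing[OF x])
      fix y :: real assume y: "1 \<le> y" "y \<le> x"
      have dD: "(D has_real_derivative D' y) (at y)"
        unfolding D_def[abs_def] D'_def by (rule bessel_clifford_DERIV[OF \<nu>])
      have "((\<lambda>x. D x / x ^ N) has_real_derivative (D' y * y ^ N - D y * (N * y ^ (N - 1))) / (y ^ N * y ^ N)) (at y)"
        using y by (auto intro!: derivative_eq_intros dD)
      moreover have "D' y * y ^ N - D y * (N * y ^ (N - 1)) \<le> 0"
      proof (cases N)
        case 0
        then show ?thesis using growth[of y] y by (simp add: mult_le_0_iff)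
      next
        case (Suc M)
        have "y ^ M * (y * D' y) \<le> y ^ M * (N * D y)"
          using growth[of y] y by (intro mult_left_mono) auto
        then show ?thesis using Suc by (simp add: algebra_simps)
      qed
      ultimately show "\<exists>d. ((\<lambda>x. D x / x ^ N) has_real_derivative d) (at y) \<and> d \<le> 0"
        using y by (intro exI conjI) (auto intro!: divide_nonpos_pos)
    qed
    then show ?thesis by simp
  qed
  define c where "c = bc_coeff \<nu> (Suc N)"
  have c: "c > 0" unfolding c_def by (rule bc_coeff_pos[OF \<nu>])
  define x where "x = max 1 (D 1 / c + 1)"
  have x1: "x \<ge> 1" "x > D 1 / c" by (auto simp: x_def)
  have "c * x = c * x ^ Suc N / x ^ N" using x1 by simp
  also have "\<dots> \<le> D x / x ^ N"
    using bessel_clifford_ge_term[OF \<nu>, of x "Suc N"] x1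
    by (intro divide_right_mono) (auto simp: c_def D_def)
  also have "\<dots> \<le> D 1" using mono x1 by blast
  finally show False using x1 c by (simp add: field_simps)
qed

section \<open>Enumerating positive zeros\<close>

text \<open>
  Counting the zeros up to a given one embeds the zero set monotonically into the natural numbers; the
  increasing enumeration of the image, pulled back, satisfies the description of \<open>pos_zeros\<close>.
\<close>

lemma pos_zeros_enumerates:
  fixes f :: "real \<Rightarrow> real"
  assumes inf: "infinite {x. 0 < x \<and> f x = 0}"
    and fin: "\<And>b. finite {x. 0 < x \<and> x \<le> b \<and> f x = 0}"
  shows "strict_mono_on {1..} (pos_zeros f)"
    and "pos_zeros f ` {1..} = {x. 0 < x \<and> f x = 0}"
proof -
  define Z where "Z = {x. 0 < x \<and> f x = 0}"
  define rank where "rank x = card {y \<in> Z. y \<le> x}" for x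
  have fin': "finite {y \<in> Z. y \<le> x}" for x
    by (rule finite_subset[OF _ fin[of x]]) (auto simp: Z_def)
  have rank: "rank x < rank y" if "x \<in> Z" "y \<in> Z" "x < y" for x y
  proof -
    have "{z \<in> Z. z \<le> x} \<subseteq> {z \<in> Z. z \<le> y}" using that by auto
    moreover have "y \<in> {z \<in> Z. z \<le> y} - {z \<in> Z. z \<le> x}" using that by auto
    ultimately show ?thesis
      unfolding rank_def by (intro psubset_card_mono[OF fin']) blast
  qed
  have rank_less_iff: "rank x < rank y \<longleftrightarrow> x < y" if "x \<in> Z" "y \<in> Z" for x y
    using rank that by (metis less_asym linorder_neqE_linordered_idom)
  have inj: "inj_on rank Z"
    by (rule inj_onI) (metis rank less_irrefl linorder_neqE_linordered_idom)
  have infR: "infinite (rank ` Z)"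
    using inf finite_imageD[OF _ inj] by (auto simp: Z_def)
  define j where "j n = (if n = 0 then 0 else inv_into Z rank (enumerate (rank ` Z) (n - 1)))" for n
  have j: "j n \<in> Z" "rank (j n) = enumerate (rank ` Z) (n - 1)" if "n \<ge> 1" for n
    using that enumerate_in_set[OF infR, of "n - 1"]
    by (auto simp: j_def inv_into_into f_inv_into_f)
  have "strict_mono_on {1..} j"
  proof (rule strict_mono_onI)
    fix m n :: nat assume mn: "m \<in> {1..}" "n \<in> {1..}" "m < n"
    then have "enumerate (rank ` Z) (m - 1) < enumerate (rank ` Z) (n - 1)"
      by (intro enumerate_mono[OF _ infR]) auto
    then show "j m < j n" using rank_less_iff[of "j m" "j n"] j[of m] j[of n] mn by simp
  qed
  moreover have "j ` {1..} = Z"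
  proof (intro equalityI subsetI)
    fix x assume x: "x \<in> Z"
    then obtain n where "enumerate (rank ` Z) n = rank x"
      using range_enumerate[OF infR] by (metis imageI rangeE)
    then have "rank (j (Suc n)) = rank x" using j[of "Suc n"] by simp
    then have "j (Suc n) = x" using inj_onD[OF inj] j(1)[of "Suc n"] x by simp
    then show "x \<in> j ` {1..}" by (intro image_eqI[of _ _ "Suc n"]) auto
  qed (use j in auto)
  moreover have "j 0 = 0" by (simp add: j_def)
  ultimately have "pos_zeros f = j" by (intro pos_zeros_eqI) (simp_all add: Z_def)
  with \<open>strict_mono_on {1..} j\<close> \<open>j ` {1..} = Z\<close>
  show "strict_mono_on {1..} (pos_zeros f)" "pos_zeros f ` {1..} = {x. 0 < x \<and> f x = 0}"
    by (simp_all add: Z_def)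
qed

text \<open>
  For nonnegative terms the limit along one exhaustion by finite sets dominates every finite partial sum,
  so unconditional summability and the value follow from it.
\<close>

lemma has_sum_of_exhaustion:
  fixes f :: "'a \<Rightarrow> real" and N :: "'a \<Rightarrow> real"
  assumes nonneg: "\<And>a. a \<in> A \<Longrightarrow> f a \<ge> 0" and fin: "\<And>R. finite {a \<in> A. N a \<le> R}"
    and lim: "((\<lambda>R. \<Sum>a | a \<in> A \<and> N a \<le> R. f a) \<longlongrightarrow> S) at_top"
  shows "(f has_sum S) A"
proof -
  have cover: "\<forall>\<^sub>F R in at_top. F \<subseteq> {a \<in> A. N a \<le> R}" if F: "finite F" "F \<subseteq> A" for F
  proof -
    have "\<forall>\<^sub>F R in at_top. \<forall>a\<in>F. N a \<le> R"
      using F(1) by (intro eventually_ball_finite) (auto simp: eventually_ge_at_top)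
    then show ?thesis by eventually_elim (use F in auto)
  qed
  have "sum f F \<le> S" if F: "F \<subseteq> A" "finite F" for F
  proof (rule tendsto_lowerbound[OF lim])
    show "\<forall>\<^sub>F R in at_top. sum f F \<le> (\<Sum>a | a \<in> A \<and> N a \<le> R. f a)"
      using cover[OF F(2,1)]
    proof eventually_elim
      case (elim R)
      then show ?case by (intro sum_mono2 fin) (use nonneg in auto)
    qed
  qed simp
  then have "f summable_on A"
    using nonneg by (intro nonneg_bdd_above_summable_on) (auto intro!: bdd_aboveI[of _ S])
  then obtain T where T: "(f has_sum T) A" by (auto simp: summable_on_def)
  have "filterlim (\<lambda>R. {a \<in> A. N a \<le> R}) (finite_subsets_at_top A) at_top"
    unfolding filterlim_finite_subsets_at_top
    using fin cover by (auto elim: eventually_mono)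
  with T have "((\<lambda>R. \<Sum>a | a \<in> A \<and> N a \<le> R. f a) \<longlongrightarrow> T) at_top"
    unfolding has_sum_def by (rule filterlim_compose)
  with lim have "S = T" by (rule tendsto_unique[rotated]) simp
  with T show ?thesis by simp
qed

section \<open>The zeros of Bessel functions and of their derivatives\<close>

lemma bessel_J_eq_clifford:
  assumes \<mu>: "\<mu> > -1" and x: "x > 0"
  shows "bessel_J \<mu> x = (x / 2) powr \<mu> * bessel_clifford \<mu> (- (x\<^sup>2 / 4))"
proof -
  have "(\<lambda>m. (x / 2) powr \<mu> * (bc_coeff \<mu> m * (- (x\<^sup>2 / 4)) ^ m)) sums
          ((x / 2) powr \<mu> * bessel_clifford \<mu> (- (x\<^sup>2 / 4)))"
    using bc_sums[OF \<mu>, of "- (x\<^sup>2 / 4) :: real"] by (intro sums_mult) simp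
  moreover have "(x / 2) powr \<mu> * (bc_coeff \<mu> m * (- (x\<^sup>2 / 4)) ^ m) =
      (-1) ^ m / (fact m * Gamma (real m + \<mu> + 1)) * (x / 2) powr (2 * real m + \<mu>)" for m
  proof -
    have "(x / 2) powr (2 * real m + \<mu>) = (x / 2) ^ (2 * m) * (x / 2) powr \<mu>"
      using x by (simp add: powr_add flip: powr_realpow)
    also have "(x / 2) ^ (2 * m) = (x\<^sup>2 / 4) ^ m"
      by (simp add: power_mult power_divide)
    finally show ?thesis
      by (subst power_minus) (simp add: bc_coeff_def)
  qed
  ultimately show ?thesis by (simp add: bessel_J_def sums_iff)
qed

lemma bessel_J_zero_iff:
  assumes "\<mu> > -1" and "x > 0"
  shows "bessel_J \<mu> x = 0 \<longleftrightarrow> bessel_clifford \<mu> (of_real (- (x\<^sup>2 / 4)) :: complex) = 0"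
  unfolding bessel_clifford_of_real[OF assms(1)] using assms by (simp add: bessel_J_eq_clifford)

text \<open>
  Differentiation produces \<open>C\<^sub>\<nu>\<^sub>+\<^sub>1\<close> and \<open>w C\<^sub>\<nu>\<^sub>+\<^sub>2\<close>; the recurrence trades the latter for \<open>C\<^sub>\<nu>\<close>, so that the condition
  for a zero of the derivative relates the two functions in the logarithmic derivative of \<open>C\<^sub>\<nu>\<close>.
\<close>

lemma bessel_J_Suc_DERIV:
  assumes \<nu>: "\<nu> > -1" and x: "x > 0"
  defines "w \<equiv> - (x\<^sup>2 / 4)"
  shows "(bessel_J (\<nu> + 1) has_real_derivative
           (x / 2) powr \<nu> * (bessel_clifford \<nu> w - (\<nu> + 1) / 2 * bessel_clifford (\<nu> + 1) w)) (at x)"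
proof -
  have \<nu>1: "\<nu> + 1 > -1" using \<nu> by simp
  have "((\<lambda>x. bessel_clifford (\<nu> + 1) (- (x\<^sup>2 / 4))) has_real_derivative
          bessel_clifford (\<nu> + 1 + 1) w * (- (x / 2))) (at x)"
    unfolding w_def by (rule DERIV_chain2[OF bessel_clifford_DERIV[OF \<nu>1]]) (auto intro!: derivative_eq_intros)
  then have "((\<lambda>x. (x / 2) powr (\<nu> + 1) * bessel_clifford (\<nu> + 1) (- (x\<^sup>2 / 4))) has_real_derivative
      (\<nu> + 1) * (x / 2) powr \<nu> / 2 * bessel_clifford (\<nu> + 1) w
        + bessel_clifford (\<nu> + 2) w * (- (x / 2)) * (x / 2) powr (\<nu> + 1)) (at x)"
    using x by (auto intro!: derivative_eq_intros simp: w_def add.assoc)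
  moreover have "(\<nu> + 1) * (x / 2) powr \<nu> / 2 * bessel_clifford (\<nu> + 1) w
        + bessel_clifford (\<nu> + 2) w * (- (x / 2)) * (x / 2) powr (\<nu> + 1)
      = (x / 2) powr \<nu> * ((\<nu> + 1) / 2 * bessel_clifford (\<nu> + 1) w + w * bessel_clifford (\<nu> + 2) w)"
    using x by (simp add: powr_add w_def power2_eq_square algebra_simps)
  moreover have "(\<nu> + 1) / 2 * bessel_clifford (\<nu> + 1) w + w * bessel_clifford (\<nu> + 2) w
      = bessel_clifford \<nu> w - (\<nu> + 1) / 2 * bessel_clifford (\<nu> + 1) w"
    using bessel_clifford_recurrence[OF \<nu>, of w] by (simp add: field_simps)
  ultimately have "((\<lambda>x. (x / 2) powr (\<nu> + 1) * bessel_clifford (\<nu> + 1) (- (x\<^sup>2 / 4))) has_real_derivative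
      (x / 2) powr \<nu> * (bessel_clifford \<nu> w - (\<nu> + 1) / 2 * bessel_clifford (\<nu> + 1) w)) (at x)"
    by (simp only:)
  then show ?thesis
    by (rule DERIV_cong_ev[OF refl _ refl, THEN iffD1, rotated])
       (rule eventually_mono[OF eventually_nhds_in_open[of "{0<..}"]], use x \<nu>1 in \<open>auto simp: bessel_J_eq_clifford\<close>)
qed

lemma finite_real_zeros_of_entire_square:
  fixes f :: "complex \<Rightarrow> complex"
  assumes "f holomorphic_on UNIV" and "f 0 \<noteq> 0"
  shows "finite {x::real. 0 < x \<and> x \<le> b \<and> f (of_real (- (x\<^sup>2 / 4))) = 0}"
proof -
  let ?g = "\<lambda>x::real. of_real (- (x\<^sup>2 / 4)) :: complex"
  let ?A = "{x::real. 0 < x \<and> x \<le> b \<and> f (?g x) = 0}"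
  have "?g ` ?A \<subseteq> {a. f a = 0 \<and> norm a \<le> b\<^sup>2}"
  proof (rule image_subsetI)
    fix x assume "x \<in> ?A"
    then have x: "0 < x" "x \<le> b" "f (?g x) = 0" by blast+
    then have "x\<^sup>2 \<le> b\<^sup>2" by (intro power_mono) auto
    moreover have "norm (?g x) = x\<^sup>2 / 4" unfolding norm_of_real by simp
    ultimately have "norm (?g x) \<le> b\<^sup>2" using zero_le_power2[of x] by linarith
    with x(3) show "?g x \<in> {a. f a = 0 \<and> norm a \<le> b\<^sup>2}" by blast
  qed
  then have "finite (?g ` ?A)" by (rule finite_subset) (rule finite_zeros_cball[OF assms])
  then show ?thesis
  proof (rule finite_imageD)
    show "inj_on ?g ?A"
    proof (rule inj_onI)
      fix x y assume "x \<in> ?A" "y \<in> ?A" "?g x = ?g y"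
      then have "x\<^sup>2 = y\<^sup>2" "x > 0" "y > 0" unfolding of_real_eq_iff by auto
      then show "x = y" by (simp add: power2_eq_iff)
    qed
  qed
qed

lemma bessel_zeros_bij:
  assumes \<nu>: "\<nu> > -1"
  shows "bij_betw (\<lambda>x. of_real (- (x\<^sup>2 / 4)) :: complex) {x. 0 < x \<and> bessel_J \<nu> x = 0}
           {a. bessel_clifford \<nu> a = 0}"
proof (rule bij_betwI')
  fix x y assume "x \<in> {x. 0 < x \<and> bessel_J \<nu> x = 0}" "y \<in> {x. 0 < x \<and> bessel_J \<nu> x = 0}"
  then show "(complex_of_real (- (x\<^sup>2 / 4)) = of_real (- (y\<^sup>2 / 4))) = (x = y)"
    unfolding of_real_eq_iff by (auto simp: power2_eq_iff)
next
  fix x assume "x \<in> {x. 0 < x \<and> bessel_J \<nu> x = 0}"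
  then show "complex_of_real (- (x\<^sup>2 / 4)) \<in> {a. bessel_clifford \<nu> a = 0}"
    using bessel_J_zero_iff[OF \<nu>, of x] by blast
next
  fix a :: complex assume "a \<in> {a. bessel_clifford \<nu> a = 0}"
  then have a: "bessel_clifford \<nu> a = 0" by simp
  note neg = bessel_clifford_zero_neg[OF \<nu> a]
  define x where "x = 2 * sqrt (- Re a)"
  have x: "x > 0" "- (x\<^sup>2 / 4) = Re a" using neg(2) by (simp_all add: x_def power_mult_distrib)
  show "\<exists>x\<in>{x. 0 < x \<and> bessel_J \<nu> x = 0}. a = of_real (- (x\<^sup>2 / 4))"
    using x neg(1) a bessel_J_zero_iff[OF \<nu> x(1)] by (intro bexI[of _ x]) auto
qed

lemma infinite_bessel_J_zeros:
  assumes "\<nu> > -1" shows "infinite {x. 0 < x \<and> bessel_J \<nu> x = 0}"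
  using bij_betw_finite[OF bessel_zeros_bij[OF assms]] infinite_bessel_clifford_zeros[OF assms] by blast

lemma finite_bessel_J_zeros:
  assumes \<nu>: "\<nu> > -1" shows "finite {x. 0 < x \<and> x \<le> b \<and> bessel_J \<nu> x = 0}"
proof -
  have "{x. 0 < x \<and> x \<le> b \<and> bessel_J \<nu> x = 0} =
        {x. 0 < x \<and> x \<le> b \<and> bessel_clifford \<nu> (of_real (- (x\<^sup>2 / 4)) :: complex) = 0}"
    using bessel_J_zero_iff[OF \<nu>] by auto
  then show ?thesis
    using finite_real_zeros_of_entire_square[OF bessel_clifford_holomorphic[OF \<nu>] bessel_clifford_0_nonzero[OF \<nu>], of b]
    by simp
qed

lemma deriv_bessel_J_Suc_zero_iff:
  assumes \<nu>: "\<nu> > -1" and x: "x > 0"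
  shows "deriv (bessel_J (\<nu> + 1)) x = 0 \<longleftrightarrow>
    bessel_clifford \<nu> (- (x\<^sup>2 / 4)) = (\<nu> + 1) / 2 * bessel_clifford (\<nu> + 1) (- (x\<^sup>2 / 4))"
  using DERIV_imp_deriv[OF bessel_J_Suc_DERIV[OF assms]] x by simp

text \<open>
  The zeros of \<open>J\<^sub>\<nu>\<^sub>+\<^sub>1\<close> are unbounded, so Rolle's theorem yields zeros of the derivative beyond every bound.
\<close>

lemma infinite_deriv_bessel_J_zeros:
  assumes \<nu>: "\<nu> > -1"
  shows "infinite {x. 0 < x \<and> deriv (bessel_J (\<nu> + 1)) x = 0}"
proof
  assume "finite {x. 0 < x \<and> deriv (bessel_J (\<nu> + 1)) x = 0}"
  then have "bdd_above {x. 0 < x \<and> deriv (bessel_J (\<nu> + 1)) x = 0}" by (rule bdd_above_finite)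
  then obtain b where b: "\<And>x. 0 < x \<Longrightarrow> deriv (bessel_J (\<nu> + 1)) x = 0 \<Longrightarrow> x \<le> b"
    unfolding bdd_above_def by blast
  have \<nu>1: "\<nu> + 1 > -1" using \<nu> by simp
  let ?Z = "{x. 0 < x \<and> bessel_J (\<nu> + 1) x = 0}"
  have beyond: "\<exists>x\<in>?Z. x > c" for c
  proof (rule ccontr)
    assume "\<not> ?thesis"
    then have "?Z \<subseteq> {x. 0 < x \<and> x \<le> c \<and> bessel_J (\<nu> + 1) x = 0}" by force
    then show False
      using finite_subset finite_bessel_J_zeros[OF \<nu>1] infinite_bessel_J_zeros[OF \<nu>1] by blast
  qed
  obtain x where x: "x \<in> ?Z" "x > b" using beyond by blast
  obtain y where y: "y \<in> ?Z" "y > x" using beyond by blast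
  have d: "(bessel_J (\<nu> + 1) has_real_derivative deriv (bessel_J (\<nu> + 1)) t) (at t)" if "t > 0" for t
    using bessel_J_Suc_DERIV[OF \<nu> that] DERIV_imp_deriv by fastforce
  have "\<exists>z. x < z \<and> z < y \<and> (*) (deriv (bessel_J (\<nu> + 1)) z) = (\<lambda>v. 0)"
  proof (rule Rolle_deriv[OF y(2)])
    show "bessel_J (\<nu> + 1) x = bessel_J (\<nu> + 1) y" using x y by simp
    show "continuous_on {x..y} (bessel_J (\<nu> + 1))"
    proof (intro continuous_at_imp_continuous_on ballI)
      fix t assume "t \<in> {x..y}"
      then have "t > 0" using x by simp
      then show "isCont (bessel_J (\<nu> + 1)) t" by (rule DERIV_isCont[OF d])
    qed
    show "(bessel_J (\<nu> + 1) has_derivative (*) (deriv (bessel_J (\<nu> + 1)) z)) (at z)" if "x < z" for z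
      using d[of z] x that by (simp add: has_field_derivative_def)
  qed
  then obtain z where z: "x < z" "(*) (deriv (bessel_J (\<nu> + 1)) z) = (\<lambda>v. 0)" by blast
  from fun_cong[OF z(2), of 1] have "deriv (bessel_J (\<nu> + 1)) z = 0" by simp
  then show False using b[of z] x z by simp
qed

text \<open>
  These zeros are zeros of the entire function \<open>G = C\<^sub>\<nu> - (\<nu> + 1)/2 C\<^sub>\<nu>\<^sub>+\<^sub>1\<close> at \<open>-x\<^sup>2/4\<close>, and \<open>G(0) = C\<^sub>\<nu>(0)/2\<close>
  by the recurrence.
\<close>

lemma finite_deriv_bessel_J_zeros:
  assumes \<nu>: "\<nu> > -1"
  shows "finite {x. 0 < x \<and> x \<le> b \<and> deriv (bessel_J (\<nu> + 1)) x = 0}"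
proof -
  have \<nu>1: "\<nu> + 1 > -1" using \<nu> by simp
  define G where "G z = bessel_clifford \<nu> z - of_real ((\<nu> + 1) / 2) * bessel_clifford (\<nu> + 1) z" for z :: complex
  have G_real: "G (of_real t) = of_real (bessel_clifford \<nu> t - (\<nu> + 1) / 2 * bessel_clifford (\<nu> + 1) t)" for t
    by (simp only: G_def bessel_clifford_of_real[OF \<nu>] bessel_clifford_of_real[OF \<nu>1] of_real_diff of_real_mult)
  have "G holomorphic_on UNIV"
    unfolding G_def by (intro holomorphic_intros bessel_clifford_holomorphic \<nu> \<nu>1)
  moreover have "G 0 \<noteq> 0"
  proof -
    have "bessel_clifford \<nu> (0::real) = (\<nu> + 1) * bessel_clifford (\<nu> + 1) 0"
      using bessel_clifford_recurrence[OF \<nu>, of "0::real"] by simp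
    then have "bessel_clifford \<nu> 0 - (\<nu> + 1) / 2 * bessel_clifford (\<nu> + 1) 0 = bessel_clifford \<nu> (0::real) / 2"
      by simp
    also have "\<dots> \<noteq> 0" using bessel_clifford_0_nonzero[OF \<nu>] by simp
    finally show ?thesis using G_real[of 0] by (metis of_real_0 of_real_eq_0_iff)
  qed
  ultimately have "finite {x::real. 0 < x \<and> x \<le> b \<and> G (of_real (- (x\<^sup>2 / 4))) = 0}"
    by (rule finite_real_zeros_of_entire_square)
  moreover have "{x. 0 < x \<and> x \<le> b \<and> deriv (bessel_J (\<nu> + 1)) x = 0}
      = {x. 0 < x \<and> x \<le> b \<and> G (of_real (- (x\<^sup>2 / 4))) = 0}"
    using deriv_bessel_J_Suc_zero_iff[OF \<nu>] unfolding G_real of_real_eq_0_iff by auto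
  ultimately show ?thesis by simp
qed

section \<open>The sum over the zeros\<close>

lemma bessel_zero_bij:
  assumes \<nu>: "\<nu> > -1"
  shows "bij_betw (bessel_zero \<nu>) {1..} {x. 0 < x \<and> bessel_J \<nu> x = 0}"
proof -
  note enum = pos_zeros_enumerates[OF infinite_bessel_J_zeros[OF \<nu>] finite_bessel_J_zeros[OF \<nu>]]
  show ?thesis
    unfolding bij_betw_def bessel_zero_def using strict_mono_on_imp_inj_on[OF enum(1)] enum(2) ..
qed

lemma bessel_deriv_zero:
  assumes "\<nu> > -1" and "n \<ge> 1"
  shows "bessel_deriv_zero (\<nu> + 1) n > 0"
    and "deriv (bessel_J (\<nu> + 1)) (bessel_deriv_zero (\<nu> + 1) n) = 0"
proof -
  have "bessel_deriv_zero (\<nu> + 1) n \<in> bessel_deriv_zero (\<nu> + 1) ` {1..}"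
    using assms(2) by (intro imageI) simp
  then have "bessel_deriv_zero (\<nu> + 1) n \<in> {x. 0 < x \<and> deriv (bessel_J (\<nu> + 1)) x = 0}"
    unfolding bessel_deriv_zero_def
    by (simp only: pos_zeros_enumerates(2)[OF infinite_deriv_bessel_J_zeros finite_deriv_bessel_J_zeros] assms(1))
  then show "bessel_deriv_zero (\<nu> + 1) n > 0"
    "deriv (bessel_J (\<nu> + 1)) (bessel_deriv_zero (\<nu> + 1) n) = 0"
    by blast+
qed

text \<open>
  The factor \<open>1/16\<close> comes from the substitution \<open>a = -j\<^sup>2/4\<close>: \<open>(x\<^sup>2 - j\<^sup>2)\<^sup>2 = 16 (w - a)\<^sup>2\<close>.
\<close>

lemma bessel_zero_sum:
  assumes \<nu>: "\<nu> > -1" and x: "x > 0" and nz: "bessel_J \<nu> x \<noteq> 0"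
  defines "w \<equiv> - (x\<^sup>2 / 4)"
  shows "((\<lambda>k. 1 / (x\<^sup>2 - (bessel_zero \<nu> k)\<^sup>2)\<^sup>2) has_sum
           ((bessel_clifford (\<nu> + 1) w / bessel_clifford \<nu> w)\<^sup>2
              - bessel_clifford (\<nu> + 2) w / bessel_clifford \<nu> w) / 16) {1..}"
    (is "(_ has_sum ?S / 16) _")
proof -
  let ?A = "{a::complex. bessel_clifford \<nu> a = 0}"
  have real: "bessel_clifford (\<nu> + 1) (of_real w :: complex) = of_real (bessel_clifford (\<nu> + 1) w)"
    "bessel_clifford (\<nu> + 2) (of_real w :: complex) = of_real (bessel_clifford (\<nu> + 2) w)"
    "bessel_clifford \<nu> (of_real w :: complex) = of_real (bessel_clifford \<nu> w)"
    using \<nu> by (simp_all add: bessel_clifford_of_real)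
  have nz': "bessel_clifford \<nu> (of_real w :: complex) \<noteq> 0"
    using nz bessel_J_zero_iff[OF \<nu> x] by (simp only: w_def not_False_eq_True)
  define f where "f a = 1 / (w - Re a)\<^sup>2" for a :: complex
  have f: "1 / (of_real w - a)\<^sup>2 = of_real (f a)" if "a \<in> ?A" for a
  proof -
    have "a = of_real (Re a)" using bessel_clifford_zero_neg(1)[OF \<nu>] that by blast
    then have "of_real w - a = of_real (w - Re a)" by (metis of_real_diff)
    then show ?thesis by (simp add: f_def)
  qed
  have "((\<lambda>R. \<Sum>a | bessel_clifford \<nu> a = 0 \<and> norm a \<le> R. 1 / (of_real w - a)\<^sup>2) \<longlongrightarrow> complex_of_real ?S) at_top"
    using bessel_clifford_logderiv(2)[OF \<nu> nz'] by (simp add: real)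
  also have "(\<lambda>R. \<Sum>a | bessel_clifford \<nu> a = 0 \<and> norm a \<le> R. 1 / (of_real w - a)\<^sup>2)
      = (\<lambda>R. complex_of_real (\<Sum>a | a \<in> ?A \<and> norm a \<le> R. f a))"
    by (rule ext, unfold of_real_sum, rule sum.cong) (use f in auto)
  finally have "((\<lambda>R. \<Sum>a | a \<in> ?A \<and> norm a \<le> R. f a) \<longlongrightarrow> ?S) at_top"
    unfolding tendsto_of_real_iff .
  then have "(f has_sum ?S) ?A"
    by (intro has_sum_of_exhaustion[where N = norm])
       (use finite_zeros_cball[OF bessel_clifford_holomorphic[OF \<nu>] bessel_clifford_0_nonzero[OF \<nu>]] in \<open>auto simp: f_def\<close>)
  then have "((\<lambda>k. f (of_real (- ((bessel_zero \<nu> k)\<^sup>2 / 4)))) has_sum ?S) {1..}"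
    using has_sum_reindex_bij_betw[OF bij_betw_trans[OF bessel_zero_bij[OF \<nu>] bessel_zeros_bij[OF \<nu>]], of f ?S]
    by (simp add: o_def)
  then have "((\<lambda>k. f (of_real (- ((bessel_zero \<nu> k)\<^sup>2 / 4))) * (1 / 16)) has_sum (?S * (1 / 16))) {1..}"
    by (rule has_sum_cmult_left)
  moreover have "f (of_real (- ((bessel_zero \<nu> k)\<^sup>2 / 4))) * (1 / 16) = 1 / (x\<^sup>2 - (bessel_zero \<nu> k)\<^sup>2)\<^sup>2" for k
  proof -
    have "w - Re (of_real (- ((bessel_zero \<nu> k)\<^sup>2 / 4))) = - ((x\<^sup>2 - (bessel_zero \<nu> k)\<^sup>2) / 4)"
      unfolding Re_complex_of_real by (simp add: w_def field_simps)
    then show ?thesis by (simp only: f_def power2_minus power_divide) simp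
  qed
  ultimately show ?thesis by simp
qed

theorem mainTheorem18:
  fixes \<nu> :: real and n :: nat
  assumes "\<nu> > -1" and "n \<ge> 1"
  shows "((\<lambda>k. 1 / ((bessel_deriv_zero (\<nu> + 1) n)\<^sup>2 - (bessel_zero \<nu> k)\<^sup>2)\<^sup>2)
           has_sum (1 / (4 * (\<nu> + 1)\<^sup>2) - 1 / (4 * (bessel_deriv_zero (\<nu> + 1) n)\<^sup>2))) {1..}"
proof -
  define x where "x = bessel_deriv_zero (\<nu> + 1) n"
  define w where "w = - (x\<^sup>2 / 4)"
  define C0 C1 C2 where "C0 = bessel_clifford \<nu> w" and "C1 = bessel_clifford (\<nu> + 1) w"
    and "C2 = bessel_clifford (\<nu> + 2) w"
  have x: "x > 0" and dx: "deriv (bessel_J (\<nu> + 1)) x = 0"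
    using bessel_deriv_zero[OF assms] by (simp_all add: x_def)
  have w: "w < 0" using x by (simp add: w_def)
  have C0: "C0 = (\<nu> + 1) / 2 * C1"
    using deriv_bessel_J_Suc_zero_iff[OF assms(1) x] dx by (simp add: C0_def C1_def w_def)
  have rec: "C0 = (\<nu> + 1) * C1 + w * C2"
    using bessel_clifford_recurrence[OF assms(1), of w] by (simp add: C0_def C1_def C2_def)
  \<comment> \<open>Otherwise C1 would vanish as well, contradicting the simplicity of the zeros.\<close>
  have C0_nz: "C0 \<noteq> 0"
  proof
    assume 0: "C0 = 0"
    then have "C1 = 0" using C0 assms(1) by simp
    with 0 show False
      using bessel_clifford_simple_zero[OF assms(1), of "of_real w"] assms(1)
      by (simp add: bessel_clifford_of_real C0_def C1_def)
  qed
  have "bessel_J \<nu> x \<noteq> 0"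
    using C0_nz x bessel_J_eq_clifford[OF assms(1) x] by (simp add: C0_def w_def)
  from bessel_zero_sum[OF assms(1) x this]
  have "((\<lambda>k. 1 / (x\<^sup>2 - (bessel_zero \<nu> k)\<^sup>2)\<^sup>2) has_sum ((C1 / C0)\<^sup>2 - C2 / C0) / 16) {1..}"
    by (simp add: C0_def C1_def C2_def w_def)
  moreover have "C1 / C0 = 2 / (\<nu> + 1)"
    using C0 C0_nz assms(1) by (simp add: field_simps)
  moreover have "C2 / C0 = - 1 / w"
  proof -
    have "w * C2 = - C0" using rec C0 by (simp add: field_simps)
    then show ?thesis using w C0_nz by (simp add: field_simps)
  qed
  moreover have "((2 / (\<nu> + 1))\<^sup>2 - (- 1 / w)) / 16 = 1 / (4 * (\<nu> + 1)\<^sup>2) - 1 / (4 * x\<^sup>2)"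
    using x assms(1) by (simp add: w_def power_divide field_simps)
  ultimately show ?thesis by (simp only: x_def)
qed

end
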